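(* Let $S$ be a numerical semigroup, let $d$ be a positive integer, and let $\zeta_d$ be a primitive $d$-th root of unity in $\mathbb{C}$. Then $$g(S/d)=\frac{1}{d}\left[g(S)+\frac{d-1}{2}-\sum_{i=1}^{d-1}H_S(\zeta_d^{\,i})\right].$$
   Context: $\mathbb{N}$ denotes the set of nonnegative integers. A numerical semigroup is a subset $S\subseteq\mathbb{N}$ that is closed under addition, contains $0$, and has finite complement in $\mathbb{N}$. The genus of $S$ is $g(S)=|\mathbb{N}\setminus S|$. For a positive integer $d$, the quotient of $S$ by $d$ is $S/d=\{x\in\mathbb{N}: dx\in S\}$, which is again a numerical semigroup. The Hilbert series of $S$ is $H_S(x)=\sum_{s\in S}x^s$. The semigroup polynomial $P_S(x)=(1-x)H_S(x)=1-(1-x)\sum_{n\in\mathbb{N}\setminus S}x^n$ is a polynomial, so $H_S$ is identified with the rational function $H_S(x)=P_S(x)/(1-x)=\frac{1}{1-x}-\sum_{n\in\mathbb{N}\setminus S}x^n$; for a complex number $z\neq 1$, $H_S(z)$ denotes the value of this rational function at $z$. *)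

theory Defs
  imports Complex_Main "HOL-Computational_Algebra.Polynomial_FPS"
begin

definition numerical_semigroup :: "nat set \<Rightarrow> bool" where
  "numerical_semigroup S \<longleftrightarrow>
     0 \<in> S \<and> (\<forall>a\<in>S. \<forall>b\<in>S. a + b \<in> S) \<and> finite (- S)"

definition genus :: "nat set \<Rightarrow> nat" where
  "genus S = card (- S)"

definition semigroup_quotient :: "nat set \<Rightarrow> nat \<Rightarrow> nat set" where
  "semigroup_quotient S d = {x. d * x \<in> S}"

lemma numerical_semigroup_quotient:
  assumes "numerical_semigroup S" and "d > 0"
  shows "numerical_semigroup (semigroup_quotient S d)"
proof -
  have "- semigroup_quotient S d = (\<lambda>x. d * x) -` (- S)"
    by (auto simp: semigroup_quotient_def)
  moreover have "finite ((\<lambda>x. d * x) -` (- S))"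
    using assms by (intro finite_vimageI) (auto simp: numerical_semigroup_def inj_on_def)
  ultimately show ?thesis
    using assms by (auto simp: numerical_semigroup_def semigroup_quotient_def distrib_left)
qed

definition hilbert_series :: "nat set \<Rightarrow> complex fps" where
  "hilbert_series S = Abs_fps (\<lambda>n. if n \<in> S then 1 else 0)"

definition semigroup_poly :: "nat set \<Rightarrow> complex poly" where
  "semigroup_poly S = 1 - [:1, -1:] * (\<Sum>n\<in>- S. monom 1 n)"

lemma fps_of_poly_semigroup_poly:
  assumes "numerical_semigroup S"
  shows "fps_of_poly (semigroup_poly S) = (1 - fps_X) * hilbert_series S"
proof -
  have fin: "finite (- S)"
    using assms by (simp add: numerical_semigroup_def)
  have X: "fps_of_poly [:1, -1:] = (1 - fps_X :: complex fps)"
    by (simp add: fps_of_poly_pCons)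
  have gaps: "fps_of_poly (\<Sum>n\<in>- S. monom 1 n) = Abs_fps (\<lambda>_. 1) - hilbert_series S"
    by (rule fps_ext)
      (use fin in \<open>auto simp: hilbert_series_def fps_sum_nth coeff_sum sum.delta'\<close>)
  have geo: "(1 - fps_X) * Abs_fps (\<lambda>_. 1 :: complex) = 1"
    by (rule fps_ext) (auto simp: algebra_simps)
  show ?thesis
    unfolding semigroup_poly_def
    by (simp only: fps_of_poly_diff fps_of_poly_mult fps_of_poly_1 X gaps right_diff_distrib geo)
      simp
qed

text \<open>
  The value at \<open>z \<noteq> 1\<close> of the rational function \<open>P\<^sub>S(x) / (1 - x)\<close> with which the Hilbert series
  is identified; the series itself need not converge at \<open>z\<close>. At \<open>z = 1\<close> the definition
  yields the meaningless value \<open>0\<close>.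
\<close>
definition hilbert_value :: "nat set \<Rightarrow> complex \<Rightarrow> complex" where
  "hilbert_value S z = poly (semigroup_poly S) z / (1 - z)"

lemma hilbert_value_altdef:
  assumes "z \<noteq> 1"
  shows "hilbert_value S z = 1 / (1 - z) - (\<Sum>n\<in>- S. z ^ n)"
  using assms
  by (simp add: hilbert_value_def semigroup_poly_def poly_sum poly_monom field_simps)

definition primitive_root_of_unity :: "nat \<Rightarrow> complex \<Rightarrow> bool" where
  "primitive_root_of_unity d z \<longleftrightarrow> d > 0 \<and> z ^ d = 1 \<and> (\<forall>k. 0 < k \<and> k < d \<longrightarrow> z ^ k \<noteq> 1)"

end

theory Submission
  imports Defs
begin

text \<open>
  The gaps of \<open>S/d\<close> are the gaps of \<open>S\<close> divisible by \<open>d\<close>, divided by \<open>d\<close>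
  (\<open>genus_quotient\<close>), and a sum over the \<open>d\<close>-th roots of unity detects divisibility by \<open>d\<close>
  (\<open>sum_powers_nontrivial_roots\<close>). Away from \<open>1\<close>, the Hilbert series is \<open>1 / (1 - z)\<close> minus the
  sum of \<open>z ^ n\<close> over the gaps \<open>n\<close>. Summing over the nontrivial \<open>d\<close>-th roots of unity \<open>z\<close>, each
  gap contributes \<open>d - 1\<close> to the subtracted part if \<open>d\<close> divides it and \<open>-1\<close> otherwise, so that the
  gaps amount to \<open>d * g(S/d) - g(S)\<close>. The pole part \<open>1 / (1 - z)\<close> sums to \<open>(d - 1) / 2\<close>, because
  its values at \<open>z\<close> and \<open>1 / z\<close> add up to \<open>1\<close> (\<open>sum_pole_part_nontrivial_roots\<close>). Solving for
  \<open>g(S/d)\<close> gives the formula.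
\<close>

lemma primitive_root_power_eq_1_iff:
  assumes "primitive_root_of_unity d \<zeta>"
  shows "\<zeta> ^ n = 1 \<longleftrightarrow> d dvd n"
proof -
  have d: "d > 0" "\<zeta> ^ d = 1" and min: "\<And>k. 0 < k \<Longrightarrow> k < d \<Longrightarrow> \<zeta> ^ k \<noteq> 1"
    using assms by (auto simp: primitive_root_of_unity_def)
  have "\<zeta> ^ n = \<zeta> ^ (d * (n div d) + n mod d)"
    by simp
  also have "\<dots> = \<zeta> ^ (n mod d)"
    by (simp only: power_add power_mult d power_one mult_1)
  finally have "\<zeta> ^ n = 1 \<longleftrightarrow> \<zeta> ^ (n mod d) = 1"
    by simp
  also have "\<dots> \<longleftrightarrow> n mod d = 0"
    using min[of "n mod d"] d(1) by (cases "n mod d = 0") auto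
  finally show ?thesis
    by (simp add: dvd_eq_mod_eq_0)
qed

text \<open>
  Over all \<open>d\<close>-th roots of unity, a geometric sum whose ratio \<open>\<zeta> ^ n\<close> is itself a \<open>d\<close>-th root of
  unity is \<open>d\<close> or \<open>0\<close> according to whether the ratio is \<open>1\<close>; here the term \<open>1\<close> of the trivial root
  is left out, since the Hilbert series has its pole there.
\<close>
lemma sum_powers_nontrivial_roots:
  assumes "primitive_root_of_unity d \<zeta>"
  shows "(\<Sum>i = 1..d - 1. (\<zeta> ^ i) ^ n) = (if d dvd n then of_nat d else 0) - 1"
proof -
  have d: "d > 0" "\<zeta> ^ d = 1"
    using assms by (auto simp: primitive_root_of_unity_def)
  have swap: "(\<zeta> ^ i) ^ n = (\<zeta> ^ n) ^ i" for i
    by (simp add: mult.commute flip: power_mult)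
  have "{..<d} = insert 0 {1..d - 1}"
    using d by auto
  then have "(\<Sum>i = 1..d - 1. (\<zeta> ^ i) ^ n) = (\<Sum>i<d. (\<zeta> ^ n) ^ i) - 1"
    by (simp add: swap)
  also have "(\<Sum>i<d. (\<zeta> ^ n) ^ i) = (if d dvd n then of_nat d else 0)"
  proof (cases "d dvd n")
    case True
    then have "\<zeta> ^ n = 1"
      using primitive_root_power_eq_1_iff[OF assms] by blast
    then show ?thesis
      using True by simp
  next
    case False
    have "(\<zeta> ^ n) ^ d = 1"
      using d by (simp flip: swap)
    then show ?thesis
      using False primitive_root_power_eq_1_iff[OF assms] by (simp add: geometric_sum)
  qed
  finally show ?thesis .
qed

text \<open>
  Reversing the order of summation replaces each root by its inverse, and
  \<open>1 / (1 - z) + 1 / (1 - 1 / z) = 1\<close>; hence twice the sum is the number of terms.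
\<close>
lemma sum_pole_part_nontrivial_roots:
  assumes "primitive_root_of_unity d \<zeta>"
  shows "(\<Sum>i = 1..d - 1. 1 / (1 - \<zeta> ^ i)) = (of_nat d - 1) / 2"
proof -
  have d: "d > 0" "\<zeta> ^ d = 1"
    using assms by (auto simp: primitive_root_of_unity_def)
  let ?f = "\<lambda>i. 1 / (1 - \<zeta> ^ i)"
  have pair: "?f i + ?f (d - i) = 1" if "i \<in> {1..d - 1}" for i
  proof -
    have ne: "\<zeta> ^ i \<noteq> 1" "\<zeta> ^ (d - i) \<noteq> 1"
      using that primitive_root_power_eq_1_iff[OF assms] by (auto dest!: dvd_imp_le)
    have "i + (d - i) = d"
      using that by auto
    then have "\<zeta> ^ i * \<zeta> ^ (d - i) = 1"
      using d by (metis power_add)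
    then have "(1 - \<zeta> ^ (d - i)) + (1 - \<zeta> ^ i) = (1 - \<zeta> ^ i) * (1 - \<zeta> ^ (d - i))"
      by (simp add: algebra_simps)
    then show ?thesis
      using ne by (simp add: add_frac_eq)
  qed
  have "(\<Sum>i = 1..d - 1. ?f i) = (\<Sum>i = 1..d - 1. ?f (d - i))"
    by (rule sum.reindex_bij_witness[where i = "\<lambda>i. d - i" and j = "\<lambda>i. d - i"]) auto
  then have "2 * (\<Sum>i = 1..d - 1. ?f i) = (\<Sum>i = 1..d - 1. ?f i + ?f (d - i))"
    by (simp add: sum.distrib)
  also have "\<dots> = (\<Sum>i = 1..d - 1. 1)"
    by (rule sum.cong) (use pair in auto)
  also have "\<dots> = of_nat d - 1"
    using d by (simp add: of_nat_diff)
  finally show ?thesis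
    by (simp add: field_simps)
qed

lemma genus_quotient:
  assumes "d > 0"
  shows "genus (semigroup_quotient S d) = card {n \<in> - S. d dvd n}"
proof -
  have "{n \<in> - S. d dvd n} = (\<lambda>x. d * x) ` (- semigroup_quotient S d)"
    by (auto simp: semigroup_quotient_def)
  moreover have "inj_on (\<lambda>x. d * x) (- semigroup_quotient S d)"
    using assms by (auto simp: inj_on_def)
  ultimately show ?thesis
    by (simp add: genus_def card_image)
qed

theorem theorem1p3:
  fixes S :: "nat set" and d :: nat and \<zeta> :: complex
  assumes "numerical_semigroup S"
    and "d > 0"
    and "primitive_root_of_unity d \<zeta>"
  shows "of_nat (genus (semigroup_quotient S d)) =
    (1 / of_nat d) * (of_nat (genus S) + (of_nat d - 1) / 2 - (\<Sum>i = 1..d - 1. hilbert_value S (\<zeta> ^ i)))"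
proof -
  have fin: "finite (- S)"
    using assms(1) by (simp add: numerical_semigroup_def)
  have "\<zeta> ^ i \<noteq> 1" if "i \<in> {1..d - 1}" for i
    using that primitive_root_power_eq_1_iff[OF assms(3)] by (auto dest!: dvd_imp_le)
  then have "(\<Sum>i = 1..d - 1. hilbert_value S (\<zeta> ^ i)) =
      (\<Sum>i = 1..d - 1. 1 / (1 - \<zeta> ^ i) - (\<Sum>n\<in>- S. (\<zeta> ^ i) ^ n))"
    by (intro sum.cong refl hilbert_value_altdef)
  also have "\<dots> = (of_nat d - 1) / 2 - (\<Sum>i = 1..d - 1. \<Sum>n\<in>- S. (\<zeta> ^ i) ^ n)"
    by (simp only: sum_subtractf sum_pole_part_nontrivial_roots[OF assms(3)])
  also have "(\<Sum>i = 1..d - 1. \<Sum>n\<in>- S. (\<zeta> ^ i) ^ n) = (\<Sum>n\<in>- S. \<Sum>i = 1..d - 1. (\<zeta> ^ i) ^ n)"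
    by (rule sum.swap)
  also have "\<dots> = (\<Sum>n\<in>- S. if d dvd n then of_nat d else 0) - of_nat (genus S)"
    by (simp only: sum_powers_nontrivial_roots[OF assms(3)] sum_subtractf) (simp add: genus_def)
  also have "(\<Sum>n\<in>- S. if d dvd n then of_nat d else 0) =
      of_nat d * (of_nat (genus (semigroup_quotient S d)) :: complex)"
    using fin by (simp add: genus_quotient[OF assms(2)] flip: sum.inter_filter)
  finally show ?thesis
    using assms(2) by simp
qed

end
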